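(* Let $X$ be a connected digital image and let $A\subseteq X$ be a retract of $X$. Then $$CFS(A) \subseteq CFS(X).$$
   Context: A digital image is a pair $(X,\kappa)$ with $X \subset \mathbb{Z}^n$ for some $n \in \mathbb{N}$ and $\kappa = \kappa(t,n)$ for some $1 \le t \le n$, where distinct points $p,q \in \mathbb{Z}^n$ are $\kappa(t,n)$-adjacent if at most $t$ of their coordinates differ by $\pm 1$ and all other coordinates coincide. One usually writes $X$ for $(X,\kappa)$. A subset $A \subseteq X$ is regarded as a digital image $(A,\kappa)$ with the same adjacency. Two disjoint subsets of $X$ are adjacent to each other if some point of one is adjacent to some point of the other. A set is connected if it is not a union of two disjoint non-empty sets that are not adjacent to each other. A function $f:(X,\kappa_1)\to(Y,\kappa_2)$ between digital images is continuous if it maps $\kappa_1$-connected subsets of $X$ to $\kappa_2$-connected subsets of $Y$; equivalently, whenever $x,y\in X$ are $\kappa_1$-adjacent, $f(x)$ and $f(y)$ are equal or $\kappa_2$-adjacent. A subset $A$ of $X$ is a retract of $X$ if there is a continuous function $r : X \to A$ (a retraction) with $r(a) = a$ for all $a\in A$. For continuous $f_1,f_2 : X \to X$ let $CF(f_1,f_2) = \{x\in X\mid f_1(x) = f_2(x) = x\}$, and let $\#$ denote cardinality. The common fixed point spectrum of $X$ is $$CFS(X) = \{\#CF(f_1,f_2) \mid f_1,f_2 : X\to X \text{ are continuous}\},$$ and similarly for $A$, with continuous self-maps of $A$. *)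

theory Defs
  imports "HOL-Analysis.Analysis" "HOL-Library.Extended_Nat"
begin

text \<open>
  The points of \<open>\<int>\<^sup>n\<close> are the elements of \<^typ>\<open>int ^ 'n\<close>, with \<open>n = CARD('n)\<close>.
\<close>

definition kappa :: "nat \<Rightarrow> int ^ 'n \<Rightarrow> int ^ 'n \<Rightarrow> bool" where
  "kappa t p q \<longleftrightarrow>
     p \<noteq> q \<and>
     card {i. \<bar>p $ i - q $ i\<bar> = 1} \<le> t \<and>
     (\<forall>i. \<bar>p $ i - q $ i\<bar> \<noteq> 1 \<longrightarrow> p $ i = q $ i)"

text \<open>
  The notions below are parametrised by an adjacency relation, to be instantiated with
  some \<open>kappa t\<close>. A subset of a digital image is again a digital image with the same relation.
\<close>

definition sets_adjacent :: "('a \<Rightarrow> 'a \<Rightarrow> bool) \<Rightarrow> 'a set \<Rightarrow> 'a set \<Rightarrow> bool" where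
  "sets_adjacent \<kappa> U V \<longleftrightarrow> (\<exists>u\<in>U. \<exists>v\<in>V. \<kappa> u v)"

definition dig_connected :: "('a \<Rightarrow> 'a \<Rightarrow> bool) \<Rightarrow> 'a set \<Rightarrow> bool" where
  "dig_connected \<kappa> S \<longleftrightarrow>
     \<not> (\<exists>U V. S = U \<union> V \<and> U \<inter> V = {} \<and> U \<noteq> {} \<and> V \<noteq> {} \<and> \<not> sets_adjacent \<kappa> U V)"

text \<open>
  A map \<open>X \<rightarrow> Y\<close> is a total function restricted to \<open>X\<close>; its values outside \<open>X\<close> play no role.
\<close>

definition dig_continuous ::
  "('a \<Rightarrow> 'a \<Rightarrow> bool) \<Rightarrow> 'a set \<Rightarrow> ('b \<Rightarrow> 'b \<Rightarrow> bool) \<Rightarrow> 'b set \<Rightarrow> ('a \<Rightarrow> 'b) \<Rightarrow> bool" where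
  "dig_continuous \<kappa>1 X \<kappa>2 Y f \<longleftrightarrow>
     f \<in> X \<rightarrow> Y \<and> (\<forall>S\<subseteq>X. dig_connected \<kappa>1 S \<longrightarrow> dig_connected \<kappa>2 (f ` S))"

definition dig_retract :: "('a \<Rightarrow> 'a \<Rightarrow> bool) \<Rightarrow> 'a set \<Rightarrow> 'a set \<Rightarrow> bool" where
  "dig_retract \<kappa> X A \<longleftrightarrow>
     A \<subseteq> X \<and> (\<exists>r. dig_continuous \<kappa> X \<kappa> A r \<and> (\<forall>a\<in>A. r a = a))"

definition CF :: "'a set \<Rightarrow> ('a \<Rightarrow> 'a) \<Rightarrow> ('a \<Rightarrow> 'a) \<Rightarrow> 'a set" where
  "CF X f1 f2 = {x \<in> X. f1 x = x \<and> f2 x = x}"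

text \<open>
  Digital images may be infinite, and \<^const>\<open>card\<close> is \<open>0\<close> on infinite sets. Subsets of \<open>\<int>\<^sup>n\<close> are
  countable, so a single value \<open>\<infinity>\<close> for the infinite ones distinguishes all cardinalities.
\<close>

definition ecard :: "'a set \<Rightarrow> enat" where
  "ecard S = (if finite S then enat (card S) else \<infinity>)"

definition CFS :: "('a \<Rightarrow> 'a \<Rightarrow> bool) \<Rightarrow> 'a set \<Rightarrow> enat set" where
  "CFS \<kappa> X =
     {ecard (CF X f1 f2) | f1 f2. dig_continuous \<kappa> X \<kappa> X f1 \<and> dig_continuous \<kappa> X \<kappa> X f2}"

end

theory Submission
  imports Defs
begin

text \<open>
  Precomposing with a retraction \<open>r : X \<rightarrow> A\<close> extends a continuous self-map \<open>f\<close> of \<open>A\<close> to the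
  continuous self-map \<open>f \<circ> r\<close> of \<open>X\<close>. This extension creates no new fixed points: its values lie in
  \<open>A\<close>, so every fixed point lies in \<open>A\<close>, where \<open>r\<close> is the identity. Extending both
  maps of a pair in this way therefore leaves the set of common fixed points unchanged
  (\<open>CF_comp_retraction\<close>), and each value in the spectrum of \<open>A\<close> is attained on \<open>X\<close> too.
\<close>

lemma dig_continuous_comp:
  assumes f: "dig_continuous \<kappa>1 X \<kappa>2 Y f" and g: "dig_continuous \<kappa>2 Y \<kappa>3 Z g"
  shows "dig_continuous \<kappa>1 X \<kappa>3 Z (g \<circ> f)"
  unfolding dig_continuous_def
proof (intro conjI allI impI)
  show "g \<circ> f \<in> X \<rightarrow> Z"
    using f g by (auto simp: dig_continuous_def)
next
  fix S assume "S \<subseteq> X" "dig_connected \<kappa>1 S"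
  with f have "f ` S \<subseteq> Y" "dig_connected \<kappa>2 (f ` S)"
    by (auto simp: dig_continuous_def)
  with g have "dig_connected \<kappa>3 (g ` f ` S)"
    by (auto simp: dig_continuous_def)
  then show "dig_connected \<kappa>3 ((g \<circ> f) ` S)"
    by (simp add: image_comp)
qed

lemma dig_continuous_enlarge_codomain:
  assumes "dig_continuous \<kappa>1 X \<kappa>2 Y f" and "Y \<subseteq> Z"
  shows "dig_continuous \<kappa>1 X \<kappa>2 Z f"
  using assms by (auto simp: dig_continuous_def)

text \<open>
  A point \<open>x\<close> of \<open>X\<close> with \<open>f1 (r x) = x\<close> is a value of \<open>f1\<close> on \<open>A\<close>; hence \<open>x \<in> A\<close> and \<open>r x = x\<close>.
\<close>

lemma CF_comp_retraction:
  assumes "A \<subseteq> X" and "r \<in> X \<rightarrow> A" and "\<And>a. a \<in> A \<Longrightarrow> r a = a" and "f1 \<in> A \<rightarrow> A"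
  shows "CF X (f1 \<circ> r) (f2 \<circ> r) = CF A f1 f2"
proof (intro equalityI subsetI)
  fix x assume "x \<in> CF X (f1 \<circ> r) (f2 \<circ> r)"
  then have x: "x \<in> X" "f1 (r x) = x" "f2 (r x) = x"
    by (auto simp: CF_def)
  with assms(2,4) have "x \<in> A"
    by (metis PiE)
  with x assms(3) show "x \<in> CF A f1 f2"
    by (simp add: CF_def)
next
  fix x assume "x \<in> CF A f1 f2"
  with assms(1,3) show "x \<in> CF X (f1 \<circ> r) (f2 \<circ> r)"
    by (auto simp: CF_def)
qed

lemma CFS_retract_subset:
  assumes "dig_retract \<kappa> X A"
  shows "CFS \<kappa> A \<subseteq> CFS \<kappa> X"
proof
  obtain r where AX: "A \<subseteq> X" and r: "dig_continuous \<kappa> X \<kappa> A r" and ra: "\<And>a. a \<in> A \<Longrightarrow> r a = a"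
    using assms by (auto simp: dig_retract_def)
  have extend: "dig_continuous \<kappa> X \<kappa> X (f \<circ> r)" if "dig_continuous \<kappa> A \<kappa> A f" for f
    using dig_continuous_comp[OF r that] AX by (rule dig_continuous_enlarge_codomain)
  fix c assume "c \<in> CFS \<kappa> A"
  then obtain f1 f2 where c: "c = ecard (CF A f1 f2)"
    and f1: "dig_continuous \<kappa> A \<kappa> A f1" and f2: "dig_continuous \<kappa> A \<kappa> A f2"
    by (auto simp: CFS_def)
  have "r \<in> X \<rightarrow> A" "f1 \<in> A \<rightarrow> A"
    using r f1 by (simp_all add: dig_continuous_def)
  then have "CF X (f1 \<circ> r) (f2 \<circ> r) = CF A f1 f2"
    using AX ra by (intro CF_comp_retraction)
  with c have "c = ecard (CF X (f1 \<circ> r) (f2 \<circ> r))"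
    by simp
  with extend[OF f1] extend[OF f2] show "c \<in> CFS \<kappa> X"
    unfolding CFS_def by blast
qed

theorem theorem5p4:
  fixes t :: nat and X A :: "(int ^ 'n) set"
  assumes "1 \<le> t" and "t \<le> CARD('n)"
    and "dig_connected (kappa t) X"
    and "dig_retract (kappa t) X A"
  shows "CFS (kappa t) A \<subseteq> CFS (kappa t) X"
  using assms(4) by (rule CFS_retract_subset)

end
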